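(* Let $n$ be a positive integer and consider the move-to-front scheme on $n$ cards with card probabilities $p_1 \geq p_2 \geq \cdots \geq p_n > 0$, $\sum_{j=1}^n p_j = 1$, and suppose that $p_j \leq 1/3$ for every $j$. Put $$\tau_u := \min\left\{ t \in \{0,1,2,\ldots\} : \sum_{j=1}^{n-1} (1-p_j)^t \leq \tfrac14 \right\}.$$ Then the mixing time $\tau_{\mathrm{mix}}$ of the move-to-front scheme satisfies $$\tfrac{1}{25}\tau_u - 1 \leq \tau_{\mathrm{mix}} \leq \tau_u .$$
   Context: Move-to-front scheme: a deck of $n$ cards labelled $1,\ldots,n$ is shuffled as follows. Each card $k$ has a fixed probability $p_k$. At each time step, independently of the past, a card is chosen, card $k$ being chosen with probability $p_k$ (regardless of its position), and the chosen card is moved to the top of the deck without altering the relative order of the other cards. This defines an irreducible aperiodic Markov chain $\{X_t\}_{t=0}^\infty$ on the set $S_n$ of orderings of the deck; let $\pi$ be its stationary distribution. Total variation norm: $\|\mu-\nu\| = \frac12\sum_{s}|\mu(s)-\nu(s)|$. Mixing time: for a fixed starting state $s$, $\tau(s) := \min\{t : \|P(X_t\in\cdot)-\pi\| \leq 1/4\}$ where $X_0=s$, and $\tau_{\mathrm{mix}} := \max_s \tau(s)$. *)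

theory Defs
  imports "HOL-Probability.Probability" "HOL-Combinatorics.Multiset_Permutations"
begin

text \<open>
  A time-homogeneous Markov chain with finite state space \<open>S\<close> is given by its transition kernel
  \<open>K :: 'a \<Rightarrow> 'a pmf\<close>, which is assumed to map \<open>S\<close> into distributions supported in \<open>S\<close>.
\<close>

definition chain_law :: "('a \<Rightarrow> 'a pmf) \<Rightarrow> 'a \<Rightarrow> nat \<Rightarrow> 'a pmf" where
  "chain_law K s t = ((\<lambda>\<mu>. bind_pmf \<mu> K) ^^ t) (return_pmf s)"

definition is_stationary :: "'a set \<Rightarrow> ('a \<Rightarrow> 'a pmf) \<Rightarrow> 'a pmf \<Rightarrow> bool" where
  "is_stationary S K \<pi> \<longleftrightarrow> set_pmf \<pi> \<subseteq> S \<and> bind_pmf \<pi> K = \<pi>"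

text \<open>Meaningful when the chain is irreducible on the finite set \<open>S\<close>, so that there is exactly one
  stationary distribution.\<close>

definition stationary_distribution :: "'a set \<Rightarrow> ('a \<Rightarrow> 'a pmf) \<Rightarrow> 'a pmf" where
  "stationary_distribution S K = (THE \<pi>. is_stationary S K \<pi>)"

definition total_variation :: "'a set \<Rightarrow> 'a pmf \<Rightarrow> 'a pmf \<Rightarrow> real" where
  "total_variation S \<mu> \<nu> = 1 / 2 * (\<Sum>s\<in>S. \<bar>pmf \<mu> s - pmf \<nu> s\<bar>)"

text \<open>The minimum is attained when the chain is irreducible and aperiodic, because then its law
  converges to the stationary distribution.\<close>

definition mixing_time_from :: "'a set \<Rightarrow> ('a \<Rightarrow> 'a pmf) \<Rightarrow> 'a \<Rightarrow> nat" where
  "mixing_time_from S K s =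
     (LEAST t. total_variation S (chain_law K s t) (stationary_distribution S K) \<le> 1 / 4)"

definition mixing_time :: "'a set \<Rightarrow> ('a \<Rightarrow> 'a pmf) \<Rightarrow> nat" where
  "mixing_time S K = (MAX s\<in>S. mixing_time_from S K s)"

text \<open>A deck is the list of its cards from top to bottom, without repetitions.\<close>

definition decks :: "nat \<Rightarrow> nat list set" where
  "decks n = permutations_of_set {1..n}"

definition move_to_front :: "'a \<Rightarrow> 'a list \<Rightarrow> 'a list" where
  "move_to_front k xs = k # remove1 k xs"

definition card_pmf :: "nat \<Rightarrow> (nat \<Rightarrow> real) \<Rightarrow> nat pmf" where
  "card_pmf n p = embed_pmf (\<lambda>k. if k \<in> {1..n} then p k else 0)"

definition mtf_kernel :: "nat \<Rightarrow> (nat \<Rightarrow> real) \<Rightarrow> nat list \<Rightarrow> nat list pmf" where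
  "mtf_kernel n p s = map_pmf (\<lambda>k. move_to_front k s) (card_pmf n p)"

definition mtf_mixing_time :: "nat \<Rightarrow> (nat \<Rightarrow> real) \<Rightarrow> nat" where
  "mtf_mixing_time n p = mixing_time (decks n) (mtf_kernel n p)"

definition tau_u :: "nat \<Rightarrow> (nat \<Rightarrow> real) \<Rightarrow> nat" where
  "tau_u n p = (LEAST t. (\<Sum>j=1..n-1. (1 - p j) ^ t) \<le> 1 / 4)"

lemma pmf_card_pmf:
  assumes "\<And>j. j \<in> {1..n} \<Longrightarrow> p j \<ge> 0" and "(\<Sum>j=1..n. p j) = 1"
  shows "pmf (card_pmf n p) k = (if k \<in> {1..n} then p k else 0)"
proof -
  let ?f = "\<lambda>k. if k \<in> {1..n} then p k else 0"
  have "(\<integral>\<^sup>+ x. ennreal (?f x) \<partial>count_space UNIV) = (\<Sum>x\<in>{1..n}. ennreal (?f x))"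
    by (rule nn_integral_count_space') auto
  also have "\<dots> = (\<Sum>x\<in>{1..n}. ennreal (p x))"
    by (rule sum.cong) auto
  also have "\<dots> = ennreal (\<Sum>x\<in>{1..n}. p x)"
    using assms(1) by (intro sum_ennreal) auto
  finally have "(\<integral>\<^sup>+ x. ennreal (?f x) \<partial>count_space UNIV) = 1"
    using assms(2) by simp
  then show ?thesis
    unfolding card_pmf_def using assms(1) by (intro pmf_embed_pmf) auto
qed

lemma move_to_front_in_decks:
  assumes "s \<in> decks n" and "k \<in> {1..n}"
  shows "move_to_front k s \<in> decks n"
  using assms by (auto simp: decks_def move_to_front_def permutations_of_set_def)

end

theory Submission
  imports Defs
begin

text \<open>
  Both bounds rest on the action of words. Reading a word \<open>w\<close> of chosen cards (most recent first)
  turns the deck \<open>s\<close> into a part that depends on \<open>w\<close> alone, followed by the cards of \<open>s\<close> which do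
  not occur in \<open>w\<close>, in their old order (\<open>foldr_move_to_front\<close>). Thus \<open>s\<close> influences the result
  only through the relative order of the untouched cards.

  Upper bound: if two decks are shuffled with the same word, they agree as soon as at most one
  card is untouched, in particular once the cards \<open>1, \<dots>, n - 1\<close> have all been chosen. By the union
  bound this fails at time \<open>t\<close> with probability at most \<open>\<Sum>j<n. (1 - p j)^t\<close>, which hence bounds
  the total variation distance between any two laws that evolve for \<open>t\<close> steps. The bound tends to
  \<open>0\<close>, so the stationary distribution exists and is unique; the bound is at most \<open>1/4\<close> at
  \<open>\<tau>\<^sub>u\<close>.

  Lower bound: let \<open>T\<close> be the mixing time and start from the sorted deck and from its reverse.
  Since the distance to the stationary law never increases, both laws at time \<open>T\<close> are within
  \<open>1/4\<close> of it, hence within \<open>1/2\<close> of each other. Drive both decks with the same word. If at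
  least two cards are untouched, the last two cards are in ascending order in the first deck and
  in descending order in the second; otherwise the decks coincide. So the probabilities that the
  last two cards ascend differ exactly by the probability that the number \<open>N\<close> of untouched cards
  is at least two, and this probability is at most \<open>1/2\<close>.

  Put \<open>y j = (1 - p j)^T\<close>, the probability that \<open>j\<close> is untouched. For \<open>j < n\<close>,
  inclusion-exclusion gives \<open>y j + y n - 1 \<le> P(N \<ge> 2) \<le> 1/2\<close>; as \<open>y\<close> is nondecreasing,
  \<open>y j \<le> 3/4\<close>. Moreover, the events of being untouched are pairwise negatively correlated, so
  \<open>N\<close> has variance at most its mean \<open>\<mu>\<close>, and Chebyshev's inequality forces \<open>\<mu> < 4\<close>. Hence
  \<open>\<Sum>j<n. y j ^ 25 \<le> (3/4)^24 * 4 \<le> 1/4\<close>, which means that \<open>\<tau>\<^sub>u \<le> 25 * T\<close>.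
\<close>

section \<open>Total variation distance\<close>

lemma total_variation_commute: "total_variation S \<mu> \<nu> = total_variation S \<nu> \<mu>"
  by (simp add: total_variation_def abs_minus_commute)

lemma total_variation_triangle:
  "total_variation S \<mu> \<rho> \<le> total_variation S \<mu> \<nu> + total_variation S \<nu> \<rho>"
proof -
  have "(\<Sum>s\<in>S. \<bar>pmf \<mu> s - pmf \<rho> s\<bar>) \<le> (\<Sum>s\<in>S. \<bar>pmf \<mu> s - pmf \<nu> s\<bar> + \<bar>pmf \<nu> s - pmf \<rho> s\<bar>)"
    by (intro sum_mono) linarith
  then show ?thesis
    unfolding total_variation_def sum.distrib by argo
qed

lemma abs_pmf_diff_le_total_variation:
  assumes "finite S" "x \<in> S"
  shows "\<bar>pmf \<mu> x - pmf \<nu> x\<bar> \<le> 2 * total_variation S \<mu> \<nu>"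
  unfolding total_variation_def
  using member_le_sum[of x S "\<lambda>s. \<bar>pmf \<mu> s - pmf \<nu> s\<bar>"] assms by simp

text \<open>The signed mass of \<open>\<mu> - \<nu>\<close> on \<open>A\<close> is the negative of that on \<open>S - A\<close>; the two together
  contribute at most \<open>\<Sum>s\<in>S. \<bar>\<mu> s - \<nu> s\<bar>\<close>.\<close>

lemma prob_diff_le_total_variation:
  assumes S: "finite S" "set_pmf \<mu> \<subseteq> S" "set_pmf \<nu> \<subseteq> S"
  shows "measure_pmf.prob \<mu> A - measure_pmf.prob \<nu> A \<le> total_variation S \<mu> \<nu>"
proof -
  define D where "D = (\<lambda>s. pmf \<mu> s - pmf \<nu> s)"
  have prob: "measure_pmf.prob \<rho> A = (\<Sum>s\<in>S \<inter> A. pmf \<rho> s)" if "set_pmf \<rho> \<subseteq> S" for \<rho>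
  proof -
    have "measure_pmf.prob \<rho> A = measure_pmf.prob \<rho> (S \<inter> A)"
      using that by (intro measure_pmf.finite_measure_eq_AE) (auto simp: AE_measure_pmf_iff)
    then show ?thesis
      using S(1) by (simp add: measure_measure_pmf_finite)
  qed
  have "(\<Sum>s\<in>S. D s) = 0"
    using S by (simp add: D_def sum_subtractf sum_pmf_eq_1)
  moreover have split: "(\<Sum>s\<in>S. f s) = (\<Sum>s\<in>S \<inter> A. f s) + (\<Sum>s\<in>S - A. f s)" for f :: "'a \<Rightarrow> real"
    using S(1) by (rule sum.Int_Diff)
  moreover have "(\<Sum>s\<in>S \<inter> A. D s) \<le> (\<Sum>s\<in>S \<inter> A. \<bar>D s\<bar>)" "(\<Sum>s\<in>S - A. - D s) \<le> (\<Sum>s\<in>S - A. \<bar>D s\<bar>)"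
    by (intro sum_mono; simp)+
  ultimately have "2 * (\<Sum>s\<in>S \<inter> A. D s) \<le> (\<Sum>s\<in>S. \<bar>D s\<bar>)"
    using split[of D] split[of "\<lambda>s. \<bar>D s\<bar>"] by (simp add: sum_negf)
  moreover have "measure_pmf.prob \<mu> A - measure_pmf.prob \<nu> A = (\<Sum>s\<in>S \<inter> A. D s)"
    using S(2,3) by (simp add: prob D_def sum_subtractf)
  ultimately show ?thesis
    unfolding total_variation_def D_def by simp
qed

text \<open>The coupling inequality: two random variables on a common space have laws whose distance is at
  most the probability that they differ.\<close>

lemma total_variation_map_le_prob_neq:
  assumes "finite S"
  shows "total_variation S (map_pmf f M) (map_pmf g M) \<le> measure_pmf.prob M {w. f w \<noteq> g w}"
proof -
  let ?P = "measure_pmf.prob M"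
  have diff: "?P (f -` {x}) - ?P (g -` {x}) \<le> ?P {w. f w = x \<and> f w \<noteq> g w}"
    for f g :: "'b \<Rightarrow> 'a" and x
  proof -
    have "?P (f -` {x}) \<le> ?P ({w. f w = x \<and> f w \<noteq> g w} \<union> g -` {x})"
      by (intro measure_pmf.finite_measure_mono) auto
    also have "\<dots> \<le> ?P {w. f w = x \<and> f w \<noteq> g w} + ?P (g -` {x})"
      by (intro measure_Un_le) auto
    finally show ?thesis by simp
  qed
  have fibres: "(\<Sum>x\<in>S. ?P {w. f w = x \<and> f w \<noteq> g w}) \<le> ?P {w. f w \<noteq> g w}" for f g :: "'b \<Rightarrow> 'a"
  proof -
    have "(\<Sum>x\<in>S. ?P {w. f w = x \<and> f w \<noteq> g w}) = ?P (\<Union>x\<in>S. {w. f w = x \<and> f w \<noteq> g w})"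
      using assms
      by (intro measure_pmf.finite_measure_finite_Union[symmetric]) (auto simp: disjoint_family_on_def)
    also have "\<dots> \<le> ?P {w. f w \<noteq> g w}"
      by (intro measure_pmf.finite_measure_mono) auto
    finally show ?thesis .
  qed
  have "\<bar>pmf (map_pmf f M) x - pmf (map_pmf g M) x\<bar>
      \<le> ?P {w. f w = x \<and> f w \<noteq> g w} + ?P {w. g w = x \<and> g w \<noteq> f w}" for x
    using diff[of f x g] diff[of g x f]
      measure_nonneg[of M "{w. f w = x \<and> f w \<noteq> g w}"] measure_nonneg[of M "{w. g w = x \<and> g w \<noteq> f w}"]
    unfolding pmf_map by linarith
  then have "(\<Sum>x\<in>S. \<bar>pmf (map_pmf f M) x - pmf (map_pmf g M) x\<bar>)
      \<le> (\<Sum>x\<in>S. ?P {w. f w = x \<and> f w \<noteq> g w} + ?P {w. g w = x \<and> g w \<noteq> f w})"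
    by (intro sum_mono)
  also have "\<dots> \<le> ?P {w. f w \<noteq> g w} + ?P {w. g w \<noteq> f w}"
    unfolding sum.distrib by (intro add_mono fibres)
  also have "{w. g w \<noteq> f w} = {w. f w \<noteq> g w}"
    by auto
  finally show ?thesis
    unfolding total_variation_def by simp
qed

lemma pmf_bind_finite:
  assumes "finite S" "set_pmf \<mu> \<subseteq> S"
  shows "pmf (bind_pmf \<mu> K) x = (\<Sum>s\<in>S. pmf \<mu> s * pmf (K s) x)"
  unfolding pmf_bind using assms by (subst integral_measure_pmf[where A = S]) auto

lemma total_variation_bind_le:
  assumes S: "finite S" "set_pmf \<mu> \<subseteq> S" "set_pmf \<nu> \<subseteq> S" and K: "\<And>s. s \<in> S \<Longrightarrow> set_pmf (K s) \<subseteq> S"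
  shows "total_variation S (bind_pmf \<mu> K) (bind_pmf \<nu> K) \<le> total_variation S \<mu> \<nu>"
proof -
  have "(\<Sum>x\<in>S. \<bar>pmf (bind_pmf \<mu> K) x - pmf (bind_pmf \<nu> K) x\<bar>)
      = (\<Sum>x\<in>S. \<bar>\<Sum>s\<in>S. (pmf \<mu> s - pmf \<nu> s) * pmf (K s) x\<bar>)"
    using S by (simp add: pmf_bind_finite[OF S(1)] sum_subtractf[symmetric] left_diff_distrib)
  also have "\<dots> \<le> (\<Sum>x\<in>S. \<Sum>s\<in>S. \<bar>pmf \<mu> s - pmf \<nu> s\<bar> * pmf (K s) x)"
    by (intro sum_mono order_trans[OF sum_abs]) (simp add: abs_mult)
  also have "\<dots> = (\<Sum>s\<in>S. \<bar>pmf \<mu> s - pmf \<nu> s\<bar> * (\<Sum>x\<in>S. pmf (K s) x))"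
    by (subst sum.swap) (simp add: sum_distrib_left)
  also have "\<dots> = (\<Sum>s\<in>S. \<bar>pmf \<mu> s - pmf \<nu> s\<bar>)"
    using S(1) K by (intro sum.cong) (simp_all add: sum_pmf_eq_1)
  finally show ?thesis
    unfolding total_variation_def by simp
qed

section \<open>Finite Markov chains\<close>

lemma chain_law_0 [simp]: "chain_law K s 0 = return_pmf s"
  by (simp add: chain_law_def)

lemma chain_law_Suc: "chain_law K s (Suc t) = bind_pmf (chain_law K s t) K"
  by (simp add: chain_law_def)

lemma chain_law_add: "chain_law K s (t + u) = bind_pmf (chain_law K s t) (\<lambda>x. chain_law K x u)"
  by (induction u) (simp_all add: bind_return_pmf' chain_law_Suc bind_assoc_pmf)

lemma set_pmf_chain_law:
  assumes "\<And>s. s \<in> S \<Longrightarrow> set_pmf (K s) \<subseteq> S" "s \<in> S"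
  shows "set_pmf (chain_law K s t) \<subseteq> S"
  using assms by (induction t) (auto simp: chain_law_Suc)

lemma stationary_bind_chain_law:
  assumes "is_stationary S K \<pi>"
  shows "bind_pmf \<pi> (\<lambda>s. chain_law K s t) = \<pi>"
  using assms
  by (induction t)
    (simp_all add: bind_return_pmf' chain_law_Suc bind_assoc_pmf[symmetric] is_stationary_def)

lemma total_variation_chain_law_antimono:
  assumes S: "finite S" "\<And>s. s \<in> S \<Longrightarrow> set_pmf (K s) \<subseteq> S" "s \<in> S"
    and \<pi>: "is_stationary S K \<pi>" and le: "t \<le> u"
  shows "total_variation S (chain_law K s u) \<pi> \<le> total_variation S (chain_law K s t) \<pi>"
  using le
proof (induction u rule: dec_induct)
  case (step u)
  have "total_variation S (chain_law K s (Suc u)) \<pi>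
      = total_variation S (bind_pmf (chain_law K s u) K) (bind_pmf \<pi> K)"
    using \<pi> by (simp add: chain_law_Suc is_stationary_def)
  also have "\<dots> \<le> total_variation S (chain_law K s u) \<pi>"
    using S \<pi> set_pmf_chain_law[OF S(2,3)]
    by (intro total_variation_bind_le) (auto simp: is_stationary_def)
  finally show ?case
    using step.IH by simp
qed simp

text \<open>If the chain forgets its initial law uniformly, then its laws from a fixed state form a
  Cauchy sequence, because running for \<open>t + u\<close> steps amounts to running for \<open>t\<close> steps from
  the random state reached after \<open>u\<close> steps. The limit is invariant since \<open>S\<close> is finite, and it is the
  only invariant law since every law is attracted to it.\<close>

lemma ex1_stationary:
  fixes \<epsilon> :: "nat \<Rightarrow> real"
  assumes S: "finite S" "S \<noteq> {}" "\<And>s. s \<in> S \<Longrightarrow> set_pmf (K s) \<subseteq> S"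
    and \<epsilon>: "\<epsilon> \<longlonglongrightarrow> 0"
    and forget: "\<And>\<mu> \<nu> t. set_pmf \<mu> \<subseteq> S \<Longrightarrow> set_pmf \<nu> \<subseteq> S \<Longrightarrow>
      total_variation S (bind_pmf \<mu> (\<lambda>s. chain_law K s t)) (bind_pmf \<nu> (\<lambda>s. chain_law K s t)) \<le> \<epsilon> t"
  shows "\<exists>!\<pi>. is_stationary S K \<pi>"
proof -
  obtain s where s: "s \<in> S"
    using S(2) by auto
  define L where "L = chain_law K s"
  have L_S: "set_pmf (L t) \<subseteq> S" for t
    unfolding L_def using set_pmf_chain_law[OF S(3) s] .
  have L_eq: "L t = bind_pmf (return_pmf s) (\<lambda>s. chain_law K s t)" for t
    by (simp add: L_def bind_return_pmf)
  have L_add: "L (t + u) = bind_pmf (L u) (\<lambda>s. chain_law K s t)" for t u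
    unfolding L_def by (subst add.commute) (rule chain_law_add)
  have near: "\<bar>pmf (L t) x - pmf (bind_pmf \<mu> (\<lambda>s. chain_law K s t)) x\<bar> \<le> 2 * \<epsilon> t"
    if "x \<in> S" "set_pmf \<mu> \<subseteq> S" for t x \<mu>
  proof -
    have "total_variation S (L t) (bind_pmf \<mu> (\<lambda>s. chain_law K s t)) \<le> \<epsilon> t"
      unfolding L_eq using s that(2) by (intro forget) auto
    then show ?thesis
      using abs_pmf_diff_le_total_variation[OF S(1) that(1), of "L t"]
      by (meson order_trans mult_left_mono zero_le_numeral)
  qed
  have "\<exists>l. (\<lambda>t. pmf (L t) x) \<longlonglongrightarrow> l" for x
  proof (cases "x \<in> S")
    case True
    have "Cauchy (\<lambda>t. pmf (L t) x)"
    proof (rule metric_CauchyI)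
      fix e :: real assume "e > 0"
      then have "\<forall>\<^sub>F t in sequentially. \<epsilon> t < e / 4"
        using \<epsilon> by (intro order_tendstoD) auto
      then obtain T where T: "\<epsilon> T < e / 4"
        by (auto simp: eventually_sequentially)
      have near_T: "\<bar>pmf (L T) x - pmf (L t) x\<bar> < e / 2" if "t \<ge> T" for t
        using near[OF True L_S, of T "t - T"] L_add[of T "t - T"] that T by simp
      have "dist (pmf (L t) x) (pmf (L u) x) < e" if "t \<ge> T" "u \<ge> T" for t u
        using near_T[OF that(1)] near_T[OF that(2)] unfolding dist_real_def by linarith
      then show "\<exists>T. \<forall>t\<ge>T. \<forall>u\<ge>T. dist (pmf (L t) x) (pmf (L u) x) < e"
        by blast
    qed
    then show ?thesis
      by (simp add: Cauchy_convergent_iff convergent_def)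
  next
    case False
    then have "pmf (L t) x = 0" for t
      using L_S[of t] by (auto simp: pmf_eq_0_set_pmf)
    then show ?thesis by auto
  qed
  then obtain q where q: "\<And>x. (\<lambda>t. pmf (L t) x) \<longlonglongrightarrow> q x"
    by metis
  have q_nonneg: "q x \<ge> 0" for x
    using q[of x] by (rule LIMSEQ_le_const) auto
  have q_outside: "q x = 0" if "x \<notin> S" for x
  proof -
    have "pmf (L t) x = 0" for t
      using that L_S[of t] by (auto simp: pmf_eq_0_set_pmf)
    then show ?thesis
      using q[of x] by (simp add: LIMSEQ_const_iff)
  qed
  have "(\<lambda>t. \<Sum>x\<in>S. pmf (L t) x) \<longlonglongrightarrow> (\<Sum>x\<in>S. q x)"
    by (intro tendsto_sum q)
  then have q_sum: "(\<Sum>x\<in>S. q x) = 1"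
    using S(1) L_S by (simp add: sum_pmf_eq_1 LIMSEQ_const_iff)
  have "(\<integral>\<^sup>+ x. ennreal (q x) \<partial>count_space UNIV) = (\<Sum>x\<in>S. ennreal (q x))"
    using S(1) q_outside by (intro nn_integral_count_space') auto
  also have "\<dots> = 1"
    using q_nonneg q_sum by (simp add: sum_ennreal)
  finally have pmf_q: "pmf (embed_pmf q) x = q x" for x
    using q_nonneg by (intro pmf_embed_pmf) auto
  have q_S: "set_pmf (embed_pmf q) \<subseteq> S"
    using q_outside by (auto simp: set_pmf_eq pmf_q)
  have "bind_pmf (embed_pmf q) K = embed_pmf q"
  proof (rule pmf_eqI)
    fix x
    have "(\<lambda>t. \<Sum>y\<in>S. pmf (L t) y * pmf (K y) x) \<longlonglongrightarrow> (\<Sum>y\<in>S. q y * pmf (K y) x)"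
      by (intro tendsto_sum tendsto_mult q tendsto_const)
    moreover have "(\<Sum>y\<in>S. pmf (L t) y * pmf (K y) x) = pmf (L (Suc t)) x" for t
      using pmf_bind_finite[OF S(1) L_S, of t K x] by (simp add: L_def chain_law_Suc)
    ultimately have "(\<lambda>t. pmf (L (Suc t)) x) \<longlonglongrightarrow> (\<Sum>y\<in>S. q y * pmf (K y) x)"
      by simp
    then have "(\<Sum>y\<in>S. q y * pmf (K y) x) = q x"
      using LIMSEQ_Suc[OF q[of x]] LIMSEQ_unique by blast
    then show "pmf (bind_pmf (embed_pmf q) K) x = pmf (embed_pmf q) x"
      by (simp add: pmf_bind_finite[OF S(1) q_S] pmf_q)
  qed
  then have "is_stationary S K (embed_pmf q)"
    using q_S by (simp add: is_stationary_def)
  moreover have "\<pi> = embed_pmf q" if \<pi>: "is_stationary S K \<pi>" for \<pi>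
  proof (rule pmf_eqI)
    fix x
    have \<pi>_S: "set_pmf \<pi> \<subseteq> S"
      using \<pi> by (simp add: is_stationary_def)
    show "pmf \<pi> x = pmf (embed_pmf q) x"
    proof (cases "x \<in> S")
      case True
      have "(\<lambda>t. pmf (L t) x - pmf \<pi> x) \<longlonglongrightarrow> 0"
      proof (rule Lim_null_comparison)
        show "\<forall>\<^sub>F t in sequentially. norm (pmf (L t) x - pmf \<pi> x) \<le> 2 * \<epsilon> t"
          using near[OF True \<pi>_S] by (simp add: stationary_bind_chain_law[OF \<pi>])
        show "(\<lambda>t. 2 * \<epsilon> t) \<longlonglongrightarrow> 0"
          using tendsto_mult_left[OF \<epsilon>, of 2] by simp
      qed
      then have "(\<lambda>t. pmf (L t) x) \<longlonglongrightarrow> pmf \<pi> x"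
        by (simp add: LIM_zero_iff)
      then show ?thesis
        using q[of x] LIMSEQ_unique by (metis pmf_q)
    next
      case False
      then show ?thesis
        using \<pi>_S q_outside by (auto simp: pmf_q pmf_eq_0_set_pmf)
    qed
  qed
  ultimately show ?thesis by blast
qed

section \<open>Counting events of a probability space\<close>

text \<open>Chebyshev's inequality for a sum of pairwise negatively correlated indicators: negative
  correlation bounds \<open>E (N * (N - 1))\<close> by \<open>\<mu>\<^sup>2\<close>, so that \<open>E ((N - \<mu>)\<^sup>2) \<le> \<mu>\<close>; and on \<open>N < 2\<close> the
  square is at least \<open>(\<mu> - 1)\<^sup>2\<close>.\<close>

lemma prob_at_most_one_event:
  fixes A :: "'b \<Rightarrow> 'a set"
  assumes M: "finite (set_pmf M)" and J: "finite J"
    and neg: "\<And>i j. i \<in> J \<Longrightarrow> j \<in> J \<Longrightarrow> i \<noteq> j \<Longrightarrow>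
      measure_pmf.prob M (A i \<inter> A j) \<le> measure_pmf.prob M (A i) * measure_pmf.prob M (A j)"
    and \<mu>: "\<mu> = (\<Sum>j\<in>J. measure_pmf.prob M (A j))" "1 \<le> \<mu>"
  shows "(\<mu> - 1)\<^sup>2 * measure_pmf.prob M {x. card {j\<in>J. x \<in> A j} < 2} \<le> \<mu>"
proof -
  let ?P = "measure_pmf.prob M" and ?E = "measure_pmf.expectation M"
  define N where "N x = (\<Sum>j\<in>J. indicator (A j) x :: real)" for x
  have int: "integrable M f" for f :: "'a \<Rightarrow> real"
    using M by (rule integrable_measure_pmf_finite)
  have N_card: "N x = real (card {j\<in>J. x \<in> A j})" for x
    using J by (simp add: N_def indicator_def sum.If_cases Int_def)
  have EN: "?E N = \<mu>"
    unfolding N_def \<mu>(1) by (simp add: Bochner_Integration.integral_sum int)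
  have "?E (\<lambda>x. (N x)\<^sup>2) = ?E (\<lambda>x. \<Sum>i\<in>J. \<Sum>j\<in>J. indicator (A i \<inter> A j) x)"
    unfolding N_def power2_eq_square sum_product by (simp add: indicator_inter_arith)
  also have "\<dots> = (\<Sum>i\<in>J. \<Sum>j\<in>J. ?P (A i \<inter> A j))"
    by (simp add: Bochner_Integration.integral_sum int)
  also have "\<dots> \<le> (\<Sum>i\<in>J. \<Sum>j\<in>J. ?P (A i) * ?P (A j) + (if j = i then ?P (A i) else 0))"
    using neg by (intro sum_mono) auto
  also have "\<dots> = \<mu>\<^sup>2 + \<mu>"
    unfolding \<mu>(1) power2_eq_square using J by (simp add: sum.distrib sum_product)
  finally have EN2: "?E (\<lambda>x. (N x)\<^sup>2) \<le> \<mu>\<^sup>2 + \<mu>" .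
  have "(\<mu> - 1)\<^sup>2 * ?P {x. card {j\<in>J. x \<in> A j} < 2}
      = ?E (\<lambda>x. (\<mu> - 1)\<^sup>2 * indicator {x. card {j\<in>J. x \<in> A j} < 2} x)"
    by simp
  also have "\<dots> \<le> ?E (\<lambda>x. (N x)\<^sup>2 - 2 * \<mu> * N x + \<mu>\<^sup>2)"
  proof (intro integral_mono int)
    fix x
    have "(\<mu> - 1)\<^sup>2 \<le> (\<mu> - N x)\<^sup>2" if "card {j\<in>J. x \<in> A j} < 2"
      using that \<mu>(2) by (intro power_mono) (auto simp: N_card)
    moreover have "(\<mu> - N x)\<^sup>2 = (N x)\<^sup>2 - 2 * \<mu> * N x + \<mu>\<^sup>2"
      by (simp add: power2_eq_square algebra_simps)
    ultimately show "(\<mu> - 1)\<^sup>2 * indicator {x. card {j\<in>J. x \<in> A j} < 2} x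
        \<le> (N x)\<^sup>2 - 2 * \<mu> * N x + \<mu>\<^sup>2"
      using zero_le_power2[of "\<mu> - N x"] by (auto simp: indicator_def)
  qed
  also have "\<dots> = ?E (\<lambda>x. (N x)\<^sup>2) - 2 * \<mu> * ?E N + \<mu>\<^sup>2"
    by (simp add: int)
  also have "\<dots> \<le> \<mu>"
    using EN2 unfolding EN by (simp add: power2_eq_square)
  finally show ?thesis .
qed

section \<open>Words of independent letters\<close>

lemma prob_replicate_pmf_subset:
  "measure_pmf.prob (replicate_pmf t M) {w. set w \<subseteq> C} = measure_pmf.prob M C ^ t"
proof (induction t)
  case (Suc t)
  have "replicate_pmf (Suc t) M = map_pmf (\<lambda>(x, w). x # w) (pair_pmf M (replicate_pmf t M))"
    by (simp add: pair_pmf_def map_bind_pmf)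
  then have "measure_pmf.prob (replicate_pmf (Suc t) M) {w. set w \<subseteq> C}
      = measure_pmf.prob (pair_pmf M (replicate_pmf t M)) (C \<times> {w. set w \<subseteq> C})"
    by (simp only: measure_map_pmf) (rule arg_cong[where f = "measure _"]; auto)
  also have "\<dots> = measure_pmf.prob (pair_pmf M (replicate_pmf t M)) 
      ((C \<inter> set_pmf M) \<times> ({w. set w \<subseteq> C} \<inter> set_pmf (replicate_pmf t M)))"
    by (intro measure_pmf.finite_measure_eq_AE) (auto simp: AE_measure_pmf_iff)
  also have "\<dots> = measure_pmf.prob M C * measure_pmf.prob (replicate_pmf t M) {w. set w \<subseteq> C}"
    by (subst measure_pmf_prob_product) (auto simp: measure_Int_set_pmf)
  finally show ?case
    using Suc.IH by simp
qed simp

section \<open>The action of words on decks\<close>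

lemma foldr_move_to_front:
  assumes "distinct s"
  shows "foldr move_to_front w s = foldr move_to_front w [] @ filter (\<lambda>x. x \<notin> set w) s
    \<and> set (foldr move_to_front w []) = set w \<and> distinct (foldr move_to_front w [])"
proof (induction w)
  case (Cons k w)
  let ?A = "foldr move_to_front w []"
  have A: "set ?A = set w" "distinct ?A"
    using Cons.IH by auto
  have "remove1 k (?A @ filter (\<lambda>x. x \<notin> set w) s)
      = remove1 k ?A @ filter (\<lambda>x. x \<notin> set (k # w)) s"
  proof (cases "k \<in> set w")
    case True
    then have "(\<lambda>x. x \<notin> set (k # w)) = (\<lambda>x. x \<notin> set w)"
      by auto
    then show ?thesis
      using True A by (simp add: remove1_append)
  next
    case False
    have "remove1 k (filter (\<lambda>x. x \<notin> set w) s) = filter (\<lambda>x. x \<noteq> k \<and> x \<notin> set w) s"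
      using assms by (simp add: distinct_remove1_removeAll removeAll_filter_not_eq)
        (rule filter_cong; auto)
    then show ?thesis
      using False A by (simp add: remove1_append remove1_idem)
  qed
  then have "foldr move_to_front (k # w) s = k # remove1 k ?A @ filter (\<lambda>x. x \<notin> set (k # w)) s"
    using Cons.IH by (metis foldr_Cons o_apply move_to_front_def)
  moreover have "foldr move_to_front (k # w) [] = k # remove1 k ?A"
    by (simp add: move_to_front_def)
  ultimately show ?case
    using A by auto
qed (use assms in simp)

text \<open>A single untouched card has no order to remember.\<close>

lemma foldr_move_to_front_eqI:
  assumes "distinct s" "distinct s'" "set s = set s'" "card (set s - set w) \<le> 1"
  shows "foldr move_to_front w s = foldr move_to_front w s'"
proof -
  let ?F = "filter (\<lambda>x. x \<notin> set w)"
  have sets: "set (?F s) = set s - set w" "set (?F s') = set s - set w"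
    using assms(3) by auto
  then have len: "length (?F s) \<le> 1" "length (?F s') \<le> 1"
    using assms by (metis distinct_card distinct_filter)+
  have "?F s = ?F s'"
  proof (cases "?F s")
    case Nil
    then show ?thesis
      using sets by (metis set_empty)
  next
    case (Cons a ys)
    then have "?F s = [a]"
      using len by simp
    moreover from this have "set (?F s') = {a}"
      using sets by simp
    then have "?F s' = [a]"
      using len(2) by (cases "?F s'") auto
    ultimately show ?thesis by simp
  qed
  then show ?thesis
    using foldr_move_to_front[OF assms(1), of w] foldr_move_to_front[OF assms(2), of w] by simp
qed

definition last_two_ascending :: "'a::linorder list \<Rightarrow> bool" where
  "last_two_ascending xs \<longleftrightarrow> last (butlast xs) < last xs"

lemma last_two_ascending_foldr_move_to_front:
  fixes s :: "'a::linorder list"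
  assumes sorted: "sorted s" "distinct s" and two: "card (set s - set w) \<ge> 2"
  shows "last_two_ascending (foldr move_to_front w s)"
    and "\<not> last_two_ascending (foldr move_to_front w (rev s))"
proof -
  let ?F = "filter (\<lambda>x. x \<notin> set w)" and ?A = "foldr move_to_front w []"
  have "set (?F s) = set s - set w"
    by auto
  then have len: "length (?F s) \<ge> 2"
    using two sorted(2) by (metis distinct_card distinct_filter)
  have ord: "sorted_wrt (<) (?F s)"
    using sorted by (simp add: strict_sorted_iff sorted_wrt_filter)
  obtain G a b where G: "?F s = G @ [a, b]"
  proof -
    obtain ys b where ys: "?F s = ys @ [b]"
      using len by (cases "?F s" rule: rev_cases) auto
    then obtain G a where "ys = G @ [a]"
      using len by (cases ys rule: rev_cases) auto
    then show ?thesis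
      using ys that by simp
  qed
  have "a < b"
    using ord unfolding G by (simp add: sorted_wrt_append)
  then show "last_two_ascending (foldr move_to_front w s)"
    using foldr_move_to_front[OF sorted(2), of w]
    by (simp add: last_two_ascending_def G butlast_append)
  obtain c d H where H: "?F s = c # d # H"
    using len by (cases "?F s"; cases "tl (?F s)") auto
  have "c < d"
    using ord unfolding H by simp
  then show "\<not> last_two_ascending (foldr move_to_front w (rev s))"
    using foldr_move_to_front[of "rev s" w] sorted(2)
    by (simp add: last_two_ascending_def H butlast_append rev_filter[symmetric])
qed

section \<open>The move-to-front chain\<close>

lemma chain_law_mtf_kernel:
  "chain_law (mtf_kernel n p) s t
    = map_pmf (\<lambda>w. foldr move_to_front w s) (replicate_pmf t (card_pmf n p))"
proof (induction t)
  case (Suc t)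
  have "chain_law (mtf_kernel n p) s (Suc t)
      = do {w \<leftarrow> replicate_pmf t (card_pmf n p); k \<leftarrow> card_pmf n p;
            return_pmf (move_to_front k (foldr move_to_front w s))}"
    by (simp add: chain_law_Suc Suc.IH mtf_kernel_def map_pmf_def bind_assoc_pmf bind_return_pmf)
  also have "\<dots> = map_pmf (\<lambda>w. foldr move_to_front w s) (replicate_pmf (Suc t) (card_pmf n p))"
    by (subst bind_commute_pmf) (simp add: map_pmf_def bind_assoc_pmf bind_return_pmf)
  finally show ?case .
qed simp

lemma finite_decks [simp]: "finite (decks n)"
  by (simp add: decks_def)

lemma in_decks_iff: "s \<in> decks n \<longleftrightarrow> set s = {1..n} \<and> distinct s"
  by (auto simp: decks_def permutations_of_set_def)

lemma sorted_deck_in_decks: "[1..<Suc n] \<in> decks n" "rev [1..<Suc n] \<in> decks n"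
  by (auto simp: in_decks_iff simp del: upt_Suc)

locale card_weights =
  fixes n :: nat and p :: "nat \<Rightarrow> real"
  assumes weight_pos: "j \<in> {1..n} \<Longrightarrow> p j > 0"
    and weight_sum: "(\<Sum>j=1..n. p j) = 1"
begin

abbreviation "words t \<equiv> replicate_pmf t (card_pmf n p)"

abbreviation "law \<equiv> chain_law (mtf_kernel n p)"

text \<open>The union bound for the event that some card other than \<open>n\<close> is not chosen within \<open>t\<close> steps.\<close>

definition coupling_bound :: "nat \<Rightarrow> real" where
  "coupling_bound t = (\<Sum>j=1..n-1. (1 - p j) ^ t)"

lemma pmf_card: "pmf (card_pmf n p) k = (if k \<in> {1..n} then p k else 0)"
  using weight_pos weight_sum by (intro pmf_card_pmf) (auto intro: less_imp_le)

lemma set_card_pmf: "set_pmf (card_pmf n p) = {1..n}"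
  using weight_pos by (force simp: set_pmf_eq pmf_card)

lemma finite_words: "finite (set_pmf (words t))"
  using finite_lists_length_eq[of "{1..n}" t]
  by (simp add: set_replicate_pmf set_card_pmf lists_eq_set)

lemma weight_le_1: "j \<in> {1..n} \<Longrightarrow> p j \<le> 1"
  using pmf_le_1[of "card_pmf n p" j] by (simp add: pmf_card)

lemma prob_untouched:
  assumes "B \<subseteq> {1..n}"
  shows "measure_pmf.prob (words t) {w. set w \<inter> B = {}} = (1 - (\<Sum>j\<in>B. p j)) ^ t"
proof -
  have fin: "finite B"
    using assms finite_subset by blast
  have "{w. set w \<inter> B = {}} = {w. set w \<subseteq> - B}"
    by auto
  then have "measure_pmf.prob (words t) {w. set w \<inter> B = {}} = measure_pmf.prob (card_pmf n p) (- B) ^ t"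
    by (simp add: prob_replicate_pmf_subset)
  moreover have "measure_pmf.prob (card_pmf n p) (- B) = 1 - measure_pmf.prob (card_pmf n p) B"
    using measure_pmf.prob_compl[of B "card_pmf n p"] by (simp add: Compl_eq_Diff_UNIV)
  moreover have "measure_pmf.prob (card_pmf n p) B = (\<Sum>j\<in>B. p j)"
    using assms fin by (subst measure_measure_pmf_finite) (auto simp: pmf_card intro!: sum.cong)
  ultimately show ?thesis by simp
qed

lemma prob_card_untouched:
  assumes "j \<in> {1..n}"
  shows "measure_pmf.prob (words t) {w. j \<notin> set w} = (1 - p j) ^ t"
proof -
  have "{w. j \<notin> set w} = {w. set w \<inter> {j} = {}}"
    by auto
  then show ?thesis
    using prob_untouched[of "{j}" t] assms by simp
qed

lemma mtf_kernel_decks: "s \<in> decks n \<Longrightarrow> set_pmf (mtf_kernel n p s) \<subseteq> decks n"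
  unfolding mtf_kernel_def set_map_pmf set_card_pmf using move_to_front_in_decks by blast

text \<open>Any two initial decks, shuffled with a common word, agree once all of \<open>1, \<dots>, n - 1\<close> have
  been chosen.\<close>

lemma total_variation_le_coupling_bound:
  assumes "set_pmf \<mu> \<subseteq> decks n" "set_pmf \<nu> \<subseteq> decks n"
  shows "total_variation (decks n) (bind_pmf \<mu> (\<lambda>s. law s t)) (bind_pmf \<nu> (\<lambda>s. law s t))
    \<le> coupling_bound t"
proof -
  define Q where "Q = pair_pmf (pair_pmf \<mu> \<nu>) (words t)"
  let ?f = "\<lambda>((s, s'), w). foldr move_to_front w s"
    and ?f' = "\<lambda>((s, s'), w). foldr move_to_front w s'"
  have \<mu>: "bind_pmf \<mu> (\<lambda>s. law s t) = map_pmf ?f Q"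
    unfolding Q_def chain_law_mtf_kernel pair_pmf_def map_pmf_def bind_assoc_pmf bind_return_pmf
      case_prod_conv by simp
  have \<nu>: "bind_pmf \<nu> (\<lambda>s. law s t) = map_pmf ?f' Q"
    unfolding Q_def chain_law_mtf_kernel pair_pmf_def map_pmf_def bind_assoc_pmf bind_return_pmf
      case_prod_conv by simp
  have agree: "foldr move_to_front w s = foldr move_to_front w s'"
    if "s \<in> decks n" "s' \<in> decks n" "\<forall>j\<in>{1..n-1}. j \<in> set w" for s s' w
  proof (rule foldr_move_to_front_eqI)
    have "{1..n} \<subseteq> insert n {1..n-1}"
      by auto
    then have "set s - set w \<subseteq> {n}"
      using that(1,3) unfolding in_decks_iff by blast
    then show "card (set s - set w) \<le> 1"
      using card_mono[of "{n}"] by force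
  qed (use that in \<open>auto simp: in_decks_iff\<close>)
  have "total_variation (decks n) (bind_pmf \<mu> (\<lambda>s. law s t)) (bind_pmf \<nu> (\<lambda>s. law s t))
      \<le> measure_pmf.prob Q {q. ?f q \<noteq> ?f' q}"
    unfolding \<mu> \<nu> by (rule total_variation_map_le_prob_neq[where f = ?f and g = ?f']) simp
  also have "\<dots> \<le> measure_pmf.prob Q (snd -` {w. \<exists>j\<in>{1..n-1}. j \<notin> set w})"
    using assms agree
    by (intro measure_pmf.finite_measure_mono_AE) (force simp: Q_def AE_measure_pmf_iff)+
  also have "\<dots> = measure_pmf.prob (words t) {w. \<exists>j\<in>{1..n-1}. j \<notin> set w}"
    unfolding Q_def by (metis map_snd_pair_pmf measure_map_pmf)
  also have "{w. \<exists>j\<in>{1..n-1}. j \<notin> set w} = (\<Union>j\<in>{1..n-1}. {w. j \<notin> set w})"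
    by auto
  also have "measure_pmf.prob (words t) \<dots>
      \<le> (\<Sum>j\<in>{1..n-1}. measure_pmf.prob (words t) {w. j \<notin> set w})"
    by (intro measure_pmf.finite_measure_subadditive_finite) auto
  also have "\<dots> = coupling_bound t"
    unfolding coupling_bound_def by (intro sum.cong prob_card_untouched) auto
  finally show ?thesis .
qed

lemma coupling_bound_tendsto_0: "coupling_bound \<longlonglongrightarrow> 0"
proof -
  have "(\<lambda>t. (1 - p j) ^ t) \<longlonglongrightarrow> 0" if "j \<in> {1..n-1}" for j
    using that weight_pos[of j] weight_le_1[of j] by (intro LIMSEQ_power_zero) auto
  then have "(\<lambda>t. \<Sum>j=1..n-1. (1 - p j) ^ t) \<longlonglongrightarrow> (\<Sum>j=1..n-1. 0)"
    by (intro tendsto_sum)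
  then show ?thesis
    by (simp add: coupling_bound_def[abs_def])
qed

lemma coupling_bound_tau_u: "coupling_bound (tau_u n p) \<le> 1 / 4"
proof -
  have "\<forall>\<^sub>F t in sequentially. coupling_bound t < 1 / 4"
    using coupling_bound_tendsto_0 by (intro order_tendstoD) auto
  then obtain t where "coupling_bound t \<le> 1 / 4"
    by (auto simp: eventually_sequentially intro: less_imp_le)
  then show ?thesis
    unfolding coupling_bound_def tau_u_def by (rule LeastI)
qed

definition stat :: "nat list pmf" where
  "stat = stationary_distribution (decks n) (mtf_kernel n p)"

lemma is_stationary_stat: "is_stationary (decks n) (mtf_kernel n p) stat"
  unfolding stat_def stationary_distribution_def
proof (rule theI', rule ex1_stationary[where \<epsilon> = coupling_bound])
  show "decks n \<noteq> {}"
    using sorted_deck_in_decks by blast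
qed (use mtf_kernel_decks coupling_bound_tendsto_0 total_variation_le_coupling_bound in auto)

lemma total_variation_stat_le:
  assumes "s \<in> decks n"
  shows "total_variation (decks n) (law s t) stat \<le> coupling_bound t"
proof -
  have "set_pmf stat \<subseteq> decks n"
    using is_stationary_stat by (simp add: is_stationary_def)
  then show ?thesis
    using total_variation_le_coupling_bound[of "return_pmf s" stat t] assms
    by (simp add: bind_return_pmf stationary_bind_chain_law[OF is_stationary_stat])
qed

lemma mixing_time_from_decks:
  assumes "s \<in> decks n"
  shows "mixing_time_from (decks n) (mtf_kernel n p) s \<le> tau_u n p"
    and "total_variation (decks n) (law s (mixing_time_from (decks n) (mtf_kernel n p) s)) stat \<le> 1 / 4"
proof -
  have "total_variation (decks n) (law s (tau_u n p)) stat \<le> 1 / 4"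
    using total_variation_stat_le[OF assms] coupling_bound_tau_u order_trans by blast
  then show "mixing_time_from (decks n) (mtf_kernel n p) s \<le> tau_u n p"
    and "total_variation (decks n) (law s (mixing_time_from (decks n) (mtf_kernel n p) s)) stat \<le> 1 / 4"
    unfolding mixing_time_from_def stat_def[symmetric] by (rule Least_le, rule LeastI)
qed

theorem mtf_mixing_time_le_tau_u: "mtf_mixing_time n p \<le> tau_u n p"
  unfolding mtf_mixing_time_def mixing_time_def
  using mixing_time_from_decks(1) sorted_deck_in_decks by (intro Max.boundedI) auto

lemma total_variation_mtf_mixing_time:
  assumes "s \<in> decks n"
  shows "total_variation (decks n) (law s (mtf_mixing_time n p)) stat \<le> 1 / 4"
proof -
  have "mixing_time_from (decks n) (mtf_kernel n p) s \<le> mtf_mixing_time n p"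
    unfolding mtf_mixing_time_def mixing_time_def using assms by (intro Max_ge) auto
  then show ?thesis
    using total_variation_chain_law_antimono[OF finite_decks mtf_kernel_decks assms is_stationary_stat]
      mixing_time_from_decks(2)[OF assms] order_trans by blast
qed

definition untouched :: "nat list \<Rightarrow> nat set" where
  "untouched w = {j \<in> {1..n}. j \<notin> set w}"

text \<open>Compare the sorted deck with its reverse under a common word. The test whether the last two
  cards ascend tells the two decks apart if at least two cards are untouched, and otherwise the
  decks are equal.\<close>

lemma prob_two_untouched_le_total_variation:
  "measure_pmf.prob (words t) {w. card (untouched w) \<ge> 2}
    \<le> total_variation (decks n) (law [1..<Suc n] t) (law (rev [1..<Suc n]) t)"
proof -
  let ?s = "[1..<Suc n]" and ?P = "measure_pmf.prob (words t)"
  let ?up = "\<lambda>s. {w. last_two_ascending (foldr move_to_front w s)}"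
  have untouched: "untouched w = set ?s - set w" for w
    by (auto simp: untouched_def simp del: upt_Suc)
  have ge2: "last_two_ascending (foldr move_to_front w ?s)"
      "\<not> last_two_ascending (foldr move_to_front w (rev ?s))"
    if "card (untouched w) \<ge> 2" for w
    using last_two_ascending_foldr_move_to_front[of ?s w] that
    by (simp_all add: untouched del: upt_Suc)
  have lt2: "foldr move_to_front w ?s = foldr move_to_front w (rev ?s)"
    if "\<not> card (untouched w) \<ge> 2" for w
    using that by (intro foldr_move_to_front_eqI) (auto simp: untouched simp del: upt_Suc)
  have "?up ?s = {w. card (untouched w) \<ge> 2} \<union> ?up (rev ?s)"
    using ge2 lt2 by fastforce
  moreover have "?P ({w. card (untouched w) \<ge> 2} \<union> ?up (rev ?s))
      = ?P {w. card (untouched w) \<ge> 2} + ?P (?up (rev ?s))"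
    using ge2 by (intro measure_pmf.finite_measure_Union) auto
  ultimately have "?P {w. card (untouched w) \<ge> 2} = ?P (?up ?s) - ?P (?up (rev ?s))"
    by simp
  also have "\<dots> = measure_pmf.prob (law ?s t) {s. last_two_ascending s}
      - measure_pmf.prob (law (rev ?s) t) {s. last_two_ascending s}"
    by (simp add: chain_law_mtf_kernel vimage_def del: upt_Suc)
  also have "\<dots> \<le> total_variation (decks n) (law ?s t) (law (rev ?s) t)"
    using set_pmf_chain_law[OF mtf_kernel_decks] sorted_deck_in_decks
    by (intro prob_diff_le_total_variation) (auto simp del: upt_Suc)
  finally show ?thesis .
qed

lemma prob_two_untouched_mtf_mixing_time:
  "measure_pmf.prob (words (mtf_mixing_time n p)) {w. card (untouched w) \<ge> 2} \<le> 1 / 2"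
proof -
  let ?T = "mtf_mixing_time n p" and ?d = "total_variation (decks n)"
  let ?L = "law [1..<Suc n] ?T" and ?L' = "law (rev [1..<Suc n]) ?T"
  have "measure_pmf.prob (words ?T) {w. card (untouched w) \<ge> 2} \<le> ?d ?L ?L'"
    by (rule prob_two_untouched_le_total_variation)
  also have "\<dots> \<le> ?d ?L stat + ?d stat ?L'"
    by (rule total_variation_triangle)
  also have "\<dots> \<le> 1 / 4 + 1 / 4"
    unfolding total_variation_commute[of "decks n" stat]
    by (intro add_mono total_variation_mtf_mixing_time sorted_deck_in_decks)
  finally show ?thesis
    by simp
qed

text \<open>Inclusion-exclusion for the events that \<open>i\<close> and \<open>j\<close> are untouched.\<close>

lemma two_cards_untouched:
  assumes "i \<in> {1..n}" "j \<in> {1..n}" "i \<noteq> j"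
  shows "(1 - p i) ^ t + (1 - p j) ^ t \<le> 1 + measure_pmf.prob (words t) {w. card (untouched w) \<ge> 2}"
proof -
  let ?P = "measure_pmf.prob (words t)" and ?U = "\<lambda>j. {w. j \<notin> set w}"
  have "?P (?U i) + ?P (?U j) = ?P (?U i \<union> ?U j) + ?P (?U i \<inter> ?U j)"
    by (simp add: measure_pmf.finite_measure_Union' measure_pmf.finite_measure_Diff' Int_commute)
  also have "\<dots> \<le> 1 + ?P {w. card (untouched w) \<ge> 2}"
  proof (intro add_mono measure_pmf.prob_le_1 measure_pmf.finite_measure_mono)
    have "card (untouched w) \<ge> 2" if "w \<in> ?U i \<inter> ?U j" for w
      using that assms card_mono[of "untouched w" "{i, j}"] by (auto simp: untouched_def)
    then show "?U i \<inter> ?U j \<subseteq> {w. card (untouched w) \<ge> 2}"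
      by auto
  qed simp
  finally show ?thesis
    using assms by (simp add: prob_card_untouched)
qed

text \<open>The negative correlation is \<open>1 - a - b \<le> (1 - a) * (1 - b)\<close>. If the mean number \<open>\<mu>\<close> were at least
  \<open>4\<close>, Chebyshev's inequality would bound \<open>1/2\<close> by \<open>\<mu> / (\<mu> - 1)\<^sup>2 \<le> 4/9\<close>.\<close>

lemma mean_untouched_less_4:
  assumes "measure_pmf.prob (words t) {w. card (untouched w) \<ge> 2} \<le> 1 / 2"
  shows "(\<Sum>j=1..n. (1 - p j) ^ t) < 4"
proof (rule ccontr)
  define \<mu> where "\<mu> = (\<Sum>j=1..n. (1 - p j) ^ t)"
  assume "\<not> ?thesis"
  then have \<mu>4: "\<mu> \<ge> 4"
    by (simp add: \<mu>_def)
  let ?P = "measure_pmf.prob (words t)" and ?U = "\<lambda>j. {w. j \<notin> set w}"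
  have neg: "?P (?U i \<inter> ?U j) \<le> ?P (?U i) * ?P (?U j)"
    if "i \<in> {1..n}" "j \<in> {1..n}" "i \<noteq> j" for i j
  proof -
    have "?U i \<inter> ?U j = {w. set w \<inter> {i, j} = {}}"
      by auto
    then have eq: "?P (?U i \<inter> ?U j) = (1 - (p i + p j)) ^ t"
      using prob_untouched[of "{i, j}" t] that by simp
    have "p i + p j \<le> (\<Sum>k=1..n. p k)"
      using that weight_pos sum_mono2[of "{1..n}" "{i, j}" p] by (auto intro: less_imp_le)
    then have "(1 - (p i + p j)) ^ t \<le> ((1 - p i) * (1 - p j)) ^ t"
      using that weight_pos[of i] weight_pos[of j] weight_sum
      by (intro power_mono) (auto simp: algebra_simps)
    then show ?thesis
      using that unfolding eq by (simp add: prob_card_untouched power_mult_distrib)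
  qed
  have mean: "\<mu> = (\<Sum>j\<in>{1..n}. ?P (?U j))"
    unfolding \<mu>_def by (intro sum.cong) (simp_all add: prob_card_untouched)
  have "(\<mu> - 1)\<^sup>2 * ?P {w. card {j\<in>{1..n}. w \<in> ?U j} < 2} \<le> \<mu>"
    using \<mu>4 by (intro prob_at_most_one_event finite_words neg mean) auto
  then have cheb: "(\<mu> - 1)\<^sup>2 * ?P {w. card (untouched w) < 2} \<le> \<mu>"
    by (simp add: untouched_def)
  have "{w. card (untouched w) < 2} = UNIV - {w. card (untouched w) \<ge> 2}"
    by auto
  then have "?P {w. card (untouched w) < 2} = 1 - ?P {w. card (untouched w) \<ge> 2}"
    using measure_pmf.prob_compl[of "{w. card (untouched w) \<ge> 2}" "words t"] by simp
  then have "(\<mu> - 1)\<^sup>2 * (1 / 2) \<le> (\<mu> - 1)\<^sup>2 * ?P {w. card (untouched w) < 2}"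
    using assms by (intro mult_left_mono) auto
  then have "(\<mu> - 1)\<^sup>2 \<le> 2 * \<mu>"
    using cheb by simp
  moreover have "4 * \<mu> \<le> \<mu> * \<mu>"
    using \<mu>4 by (intro mult_right_mono) auto
  ultimately show False
    by (simp add: power2_eq_square algebra_simps)
qed

theorem tau_u_le_mtf_mixing_time:
  assumes antimono: "\<And>i j. 1 \<le> i \<Longrightarrow> i \<le> j \<Longrightarrow> j \<le> n \<Longrightarrow> p j \<le> p i"
  shows "tau_u n p \<le> 25 * mtf_mixing_time n p"
proof -
  define T where "T = mtf_mixing_time n p"
  define y where "y j = (1 - p j) ^ T" for j
  have two: "measure_pmf.prob (words T) {w. card (untouched w) \<ge> 2} \<le> 1 / 2"
    unfolding T_def by (rule prob_two_untouched_mtf_mixing_time)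
  have y_nonneg: "y j \<ge> 0" if "j \<in> {1..n}" for j
    using weight_le_1[OF that] by (simp add: y_def)
  have y_le: "y j \<le> 3 / 4" if j: "j \<in> {1..n-1}" for j
  proof -
    have "y j + y n \<le> 1 + 1 / 2"
      using two_cards_untouched[of j n T] two j unfolding y_def by fastforce
    moreover have "y j \<le> y n"
      unfolding y_def using j antimono[of j n] weight_le_1[of j] by (intro power_mono) auto
    ultimately show ?thesis by simp
  qed
  \<comment> \<open>Of the 25 factors \<open>y j\<close>, 24 are bounded by \<open>3/4\<close>; the last is kept, to be summed.\<close>
  have "coupling_bound (25 * T) \<le> (\<Sum>j=1..n-1. (3 / 4) ^ 24 * y j)"
    unfolding coupling_bound_def
  proof (intro sum_mono)
    fix j assume j: "j \<in> {1..n-1}"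
    then have "y j \<ge> 0"
      by (intro y_nonneg) auto
    have "(1 - p j) ^ (25 * T) = y j ^ 24 * y j"
      unfolding y_def by (simp add: power_mult[symmetric] power_add[symmetric] mult.commute)
    also have "\<dots> \<le> (3 / 4) ^ 24 * y j"
      using \<open>y j \<ge> 0\<close> y_le[OF j] by (intro mult_right_mono power_mono) auto
    finally show "(1 - p j) ^ (25 * T) \<le> (3 / 4) ^ 24 * y j" .
  qed
  also have "\<dots> \<le> (3 / 4) ^ 24 * (\<Sum>j=1..n. y j)"
    unfolding sum_distrib_left[symmetric] using y_nonneg by (intro mult_left_mono sum_mono2) auto
  also have "\<dots> \<le> (3 / 4) ^ 24 * 4"
    using mean_untouched_less_4[OF two] by (intro mult_left_mono) (auto simp: y_def)
  also have "\<dots> \<le> (1 / 4 :: real)"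
    by (simp add: field_simps)
  finally show ?thesis
    unfolding coupling_bound_def tau_u_def T_def by (rule Least_le)
qed

end

theorem theorem3p1:
  fixes n :: nat and p :: "nat \<Rightarrow> real"
  assumes "n \<ge> 1"
    and "\<forall>i j. 1 \<le> i \<and> i \<le> j \<and> j \<le> n \<longrightarrow> p j \<le> p i"
    and "p n > 0"
    and "(\<Sum>j=1..n. p j) = 1"
    and "\<forall>j\<in>{1..n}. p j \<le> 1 / 3"
  shows "1 / 25 * real (tau_u n p) - 1 \<le> real (mtf_mixing_time n p)
       \<and> mtf_mixing_time n p \<le> tau_u n p"
proof -
  interpret card_weights n p
  proof
    show "p j > 0" if "j \<in> {1..n}" for j
      using that assms(2,3) by (meson atLeastAtMost_iff le_refl order_less_le_trans)
  qed (fact assms(4))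
  have "real (tau_u n p) \<le> real (25 * mtf_mixing_time n p)"
    using tau_u_le_mtf_mixing_time assms(2) of_nat_le_iff by blast
  then show ?thesis
    using mtf_mixing_time_le_tau_u by simp
qed

end
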